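(* Let $A\subseteq B$ be an integral, birational extension of integral domains. Suppose $M\mathcal{I}(A,B)=0$. Then $A$ is subintegrally closed in $B$ and the extension $A\subseteq B$ is anodal.
   Context: All rings are commutative with $1$ and ring homomorphisms are unitary; $X$ is an indeterminate. An extension $A\subseteq B$ of domains is birational if $A$ and $B$ have the same quotient field. For a ring extension $A\subseteq B$, an $A$-submodule $I$ of $B$ is invertible if there is an $A$-submodule $J$ of $B$ with $IJ=A$; $\mathcal{I}(A,B)$ is the group, under multiplication, of invertible $A$-submodules of $B$. $M\mathcal{I}(A,B)$ denotes the cokernel of the natural map $\mathcal{I}(A,B)\to\mathcal{I}(A[X,X^{-1}],B[X,X^{-1}])$, $I\mapsto I A[X,X^{-1}]$; "$=0$" means that this group is trivial. $A$ is subintegrally closed in $B$ if whenever $b\in B$ and $b^2,b^3\in A$ then $b\in A$. The extension $A\subseteq B$ is anodal if every $b\in B$ such that $b^2-b\in A$ and $b^3-b^2\in A$ belongs to $A$. *)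

theory Defs
  imports
    "HOL-Library.Poly_Mapping"
    "HOL-Computational_Algebra.Polynomial"
    "HOL-Computational_Algebra.Fraction_Field"
    "HOL-Algebra.Elementary_Groups"
begin

text \<open>
  In a ring extension \<open>A \<subseteq> B\<close> the big ring \<open>B\<close> is a type of class \<^class>\<open>comm_ring_1\<close>
  (or \<^class>\<open>idom\<close>) and \<open>A\<close> is a subset of it.
\<close>

definition is_subring :: "'b::comm_ring_1 set \<Rightarrow> bool" where
  "is_subring A \<longleftrightarrow>
     1 \<in> A \<and> (\<forall>a\<in>A. \<forall>b\<in>A. a - b \<in> A) \<and> (\<forall>a\<in>A. \<forall>b\<in>A. a * b \<in> A)"

definition integral_extension :: "'b::comm_ring_1 set \<Rightarrow> bool" where
  "integral_extension A \<longleftrightarrow>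
     (\<forall>b. \<exists>p::'b poly. lead_coeff p = 1 \<and> (\<forall>i. coeff p i \<in> A) \<and> poly p b = 0)"

text \<open>
  The quotient field of \<open>A\<close> is taken inside the quotient field \<^typ>\<open>'b fract\<close> of \<open>B\<close>.
\<close>

definition birational_extension :: "'b::idom set \<Rightarrow> bool" where
  "birational_extension A \<longleftrightarrow>
     {Fract a s | a s. a \<in> A \<and> s \<in> A \<and> s \<noteq> 0} = (UNIV :: 'b fract set)"

definition is_submodule :: "'b::comm_ring_1 set \<Rightarrow> 'b set \<Rightarrow> bool" where
  "is_submodule A I \<longleftrightarrow>
     0 \<in> I \<and> (\<forall>x\<in>I. \<forall>y\<in>I. x + y \<in> I) \<and> (\<forall>a\<in>A. \<forall>x\<in>I. a * x \<in> I)"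

definition mod_prod :: "'b::comm_ring_1 set \<Rightarrow> 'b set \<Rightarrow> 'b set" where
  "mod_prod I J = {\<Sum>k<n. f k * g k | (n::nat) f g. \<forall>k<n. f k \<in> I \<and> g k \<in> J}"

definition invertible_submodule :: "'b::comm_ring_1 set \<Rightarrow> 'b set \<Rightarrow> bool" where
  "invertible_submodule A I \<longleftrightarrow>
     is_submodule A I \<and> (\<exists>J. is_submodule A J \<and> mod_prod I J = A)"

definition inv_group :: "'b::comm_ring_1 set \<Rightarrow> 'b set monoid" where
  "inv_group A =
     \<lparr>carrier = {I. invertible_submodule A I}, monoid.mult = mod_prod, one = A\<rparr>"

text \<open>
  The Laurent polynomial ring \<open>B[X, X\<^sup>-\<^sup>1]\<close> is the group ring \<^typ>\<open>int \<Rightarrow>\<^sub>0 'b\<close>,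
  i.e. the finitely supported maps from exponents to coefficients, with the convolution
  product; the constant \<open>b\<close> is \<^term>\<open>Poly_Mapping.single (0::int) b\<close>.
\<close>

definition laurent :: "'b::comm_ring_1 set \<Rightarrow> (int \<Rightarrow>\<^sub>0 'b) set" where
  "laurent A = {p. \<forall>i. poly_mapping.lookup p i \<in> A}"

definition laurent_extend :: "'b::comm_ring_1 set \<Rightarrow> 'b set \<Rightarrow> (int \<Rightarrow>\<^sub>0 'b) set" where
  "laurent_extend A I = mod_prod (Poly_Mapping.single 0 ` I) (laurent A)"

definition MI :: "'b::comm_ring_1 set \<Rightarrow> (int \<Rightarrow>\<^sub>0 'b) set set monoid" where
  "MI A = inv_group (laurent A) Mod (laurent_extend A ` carrier (inv_group A))"

definition subintegrally_closed :: "'b::comm_ring_1 set \<Rightarrow> bool" where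
  "subintegrally_closed A \<longleftrightarrow> (\<forall>b. b ^ 2 \<in> A \<and> b ^ 3 \<in> A \<longrightarrow> b \<in> A)"

definition anodal :: "'b::comm_ring_1 set \<Rightarrow> bool" where
  "anodal A \<longleftrightarrow> (\<forall>b. b ^ 2 - b \<in> A \<and> b ^ 3 - b ^ 2 \<in> A \<longrightarrow> b \<in> A)"


lemma is_subring_closed:
  assumes "is_subring A"
  shows "1 \<in> A" "0 \<in> A" "a \<in> A \<Longrightarrow> b \<in> A \<Longrightarrow> a - b \<in> A"
    "a \<in> A \<Longrightarrow> b \<in> A \<Longrightarrow> a + b \<in> A" "a \<in> A \<Longrightarrow> b \<in> A \<Longrightarrow> a * b \<in> A"
proof -
  show "1 \<in> A" and d: "\<And>a b. a \<in> A \<Longrightarrow> b \<in> A \<Longrightarrow> a - b \<in> A"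
    and "a \<in> A \<Longrightarrow> b \<in> A \<Longrightarrow> a * b \<in> A"
    using assms by (auto simp: is_subring_def)
  show z: "0 \<in> A" using d[OF \<open>1 \<in> A\<close> \<open>1 \<in> A\<close>] by simp
  show "a + b \<in> A" if "a \<in> A" "b \<in> A"
    using d[OF that(1) d[OF z that(2)]] by simp
qed

lemma is_submodule_self: "is_subring A \<Longrightarrow> is_submodule A A"
  by (simp add: is_submodule_def is_subring_closed)

lemma mod_prod_zero: "0 \<in> mod_prod I J"
  unfolding mod_prod_def by (rule CollectI, rule exI[of _ 0]) auto

lemma mod_prod_base: "x \<in> I \<Longrightarrow> y \<in> J \<Longrightarrow> x * y \<in> mod_prod I J"
  unfolding mod_prod_def
  by (rule CollectI, rule exI[of _ 1], rule exI[of _ "\<lambda>_. x"], rule exI[of _ "\<lambda>_. y"]) auto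

lemma sum_lessThan_append:
  "(\<Sum>k<m + n. h k) = (\<Sum>k<m. h k) + (\<Sum>k<(n::nat). h (m + k :: nat) :: 'b::comm_ring_1)"
  by (induction n) (auto simp: algebra_simps)

lemma mod_prod_add:
  assumes "x \<in> mod_prod I J" "y \<in> mod_prod I J"
  shows "x + y \<in> mod_prod I J"
proof -
  from assms obtain m f g n f' g' where
    x: "x = (\<Sum>k<(m::nat). f k * g k)" "\<forall>k<m. f k \<in> I \<and> g k \<in> J" and
    y: "y = (\<Sum>k<(n::nat). f' k * g' k)" "\<forall>k<n. f' k \<in> I \<and> g' k \<in> J"
    unfolding mod_prod_def by blast
  define F where "F = (\<lambda>k. if k < m then f k else f' (k - m))"
  define G where "G = (\<lambda>k. if k < m then g k else g' (k - m))"
  have "x + y = (\<Sum>k<m + n. F k * G k)"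
    unfolding sum_lessThan_append x(1) y(1) by (simp add: F_def G_def)
  moreover have "\<forall>k<m + n. F k \<in> I \<and> G k \<in> J"
    using x(2) y(2) by (auto simp: F_def G_def)
  ultimately show ?thesis unfolding mod_prod_def by blast
qed

lemma mod_prod_least:
  assumes "0 \<in> K" "\<And>x y. x \<in> K \<Longrightarrow> y \<in> K \<Longrightarrow> x + y \<in> K"
    and "\<And>x y. x \<in> I \<Longrightarrow> y \<in> J \<Longrightarrow> x * y \<in> K"
  shows "mod_prod I J \<subseteq> K"
proof
  fix z assume "z \<in> mod_prod I J"
  then obtain n f g where z: "z = (\<Sum>k<(n::nat). f k * g k)" "\<forall>k<n. f k \<in> I \<and> g k \<in> J"
    unfolding mod_prod_def by blast
  have "\<forall>k<n. f k \<in> I \<and> g k \<in> J \<Longrightarrow> (\<Sum>k<n. f k * g k) \<in> K"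
    by (induction n) (auto intro: assms)
  with z show "z \<in> K" by simp
qed

lemma mod_prod_commute: "mod_prod I J = mod_prod J I"
proof -
  have "mod_prod I J \<subseteq> mod_prod J I" for I J :: "'a::comm_ring_1 set"
    by (intro mod_prod_least mod_prod_zero mod_prod_add) (metis mod_prod_base mult.commute)+
  then show ?thesis by blast
qed

lemma mod_prod_assoc_le: "mod_prod (mod_prod I J) K \<subseteq> mod_prod I (mod_prod J K)"
proof (intro mod_prod_least mod_prod_zero mod_prod_add)
  fix x z assume "x \<in> mod_prod I J" and z: "z \<in> K"
  have "mod_prod I J \<subseteq> {x. x * z \<in> mod_prod I (mod_prod J K)}"
    by (rule mod_prod_least)
       (auto simp: mod_prod_zero distrib_right mult.assoc intro!: mod_prod_add mod_prod_base z)
  with \<open>x \<in> mod_prod I J\<close> show "x * z \<in> mod_prod I (mod_prod J K)" by blast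
qed

lemma mod_prod_assoc: "mod_prod (mod_prod I J) K = mod_prod I (mod_prod J K)"
proof
  show "mod_prod (mod_prod I J) K \<subseteq> mod_prod I (mod_prod J K)"
    by (rule mod_prod_assoc_le)
  show "mod_prod I (mod_prod J K) \<subseteq> mod_prod (mod_prod I J) K"
    using mod_prod_assoc_le[of K J I] by (metis mod_prod_commute)
qed

lemma is_submodule_mod_prod:
  assumes "is_submodule A I" shows "is_submodule A (mod_prod I J)"
  unfolding is_submodule_def
proof (intro conjI ballI mod_prod_zero mod_prod_add)
  fix a x assume a: "a \<in> A" and "x \<in> mod_prod I J"
  have "mod_prod I J \<subseteq> {x. a * x \<in> mod_prod I J}"
    using assms a
    by (intro mod_prod_least)
       (auto simp: mod_prod_zero distrib_left is_submodule_def mult.assoc[symmetric]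
          intro!: mod_prod_add mod_prod_base)
  with \<open>x \<in> mod_prod I J\<close> show "a * x \<in> mod_prod I J" by blast
qed

lemma mod_prod_one:
  assumes "is_subring A" "is_submodule A I" shows "mod_prod A I = I"
proof
  show "mod_prod A I \<subseteq> I"
    using assms(2) by (intro mod_prod_least) (auto simp: is_submodule_def)
  show "I \<subseteq> mod_prod A I"
    using mod_prod_base[of 1 A _ I] is_subring_closed(1)[OF assms(1)] by auto
qed

lemma invertible_submodule_mod_prod:
  assumes "is_subring A" "invertible_submodule A I" "invertible_submodule A J"
  shows "invertible_submodule A (mod_prod I J)"
proof -
  obtain I' J' where
    I': "is_submodule A I" "is_submodule A I'" "mod_prod I I' = A" and
    J': "is_submodule A J" "is_submodule A J'" "mod_prod J J' = A"
    using assms(2,3) unfolding invertible_submodule_def by blast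
  have "mod_prod (mod_prod I J) (mod_prod J' I') = mod_prod I (mod_prod (mod_prod J J') I')"
    by (simp add: mod_prod_assoc)
  also have "\<dots> = A"
    using I' J' assms(1) by (simp add: mod_prod_one)
  finally show ?thesis
    using I' J' is_submodule_mod_prod unfolding invertible_submodule_def by blast
qed

lemma comm_group_inv_group:
  assumes "is_subring A" shows "comm_group (inv_group A)"
proof (rule comm_groupI; unfold inv_group_def; simp)
  show "invertible_submodule A A"
    unfolding invertible_submodule_def
    using is_submodule_self[OF assms] mod_prod_one[OF assms] by blast
next
  fix I J assume "invertible_submodule A I" "invertible_submodule A J"
  then show "invertible_submodule A (mod_prod I J)"
    by (rule invertible_submodule_mod_prod[OF assms])
next
  fix I assume "invertible_submodule A I"
  then show "mod_prod A I = I"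
    using mod_prod_one[OF assms] by (simp add: invertible_submodule_def)
next
  fix I assume "invertible_submodule A I"
  then show "\<exists>J. invertible_submodule A J \<and> mod_prod J I = A"
    unfolding invertible_submodule_def by (metis mod_prod_commute)
next
  show "mod_prod I J = mod_prod J I" for I J :: "'a set"
    by (rule mod_prod_commute)
qed (simp add: mod_prod_assoc)

lemma is_subring_laurent:
  assumes "is_subring A" shows "is_subring (laurent A)"
  unfolding is_subring_def
proof (intro conjI ballI)
  note A = is_subring_closed[OF assms]
  have add: "p + q \<in> laurent A" if "p \<in> laurent A" "q \<in> laurent A" for p q
    using that A(4) by (simp add: laurent_def lookup_add)
  have zero: "0 \<in> laurent A" using A(2) by (simp add: laurent_def)
  have single: "Poly_Mapping.single i a \<in> laurent A" if "a \<in> A" for i a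
    using that A(2) by (simp add: laurent_def lookup_single when_def)
  have ind: "P p"
    if p: "p \<in> laurent A" and "P 0" and step: "\<And>i a q. a \<in> A \<Longrightarrow> P q \<Longrightarrow> P (Poly_Mapping.single i a + q)"
    for p and P :: "(int \<Rightarrow>\<^sub>0 'a) \<Rightarrow> bool"
  proof -
    have "P (\<Sum>i\<in>S. Poly_Mapping.single i (poly_mapping.lookup p i))" if "finite S" for S
      using that p \<open>P 0\<close> step by (induction S) (auto simp: laurent_def)
    moreover have "(\<Sum>i\<in>Poly_Mapping.keys p. Poly_Mapping.single i (poly_mapping.lookup p i)) = p"
      by (rule poly_mapping_eqI)
         (auto simp: lookup_sum lookup_single when_def in_keys_iff)
    ultimately show "P p" by (metis finite_keys)
  qed
  show "1 \<in> laurent A"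
    using single[OF A(1), of 0] by simp
  show "p - q \<in> laurent A" if "p \<in> laurent A" "q \<in> laurent A" for p q
    using that A(3) by (simp add: laurent_def lookup_minus)
  show "p * q \<in> laurent A" if p: "p \<in> laurent A" and q: "q \<in> laurent A" for p q
  proof (rule ind[OF p])
    fix i a r assume a: "a \<in> A" and r: "r * q \<in> laurent A"
    have "Poly_Mapping.single i a * q \<in> laurent A"
      by (rule ind[OF q]) (auto simp: zero distrib_left mult_single intro!: add single A(5) a)
    with r show "(Poly_Mapping.single i a + r) * q \<in> laurent A"
      by (simp add: distrib_right add)
  qed (simp add: zero)
qed

lemma laurent_extend_one:
  assumes "is_subring A" shows "laurent_extend A A = laurent A"
proof -
  note L = is_subring_closed[OF is_subring_laurent[OF assms]]
  have s: "Poly_Mapping.single 0 ` A \<subseteq> laurent A"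
    using is_subring_closed(2)[OF assms] by (auto simp: laurent_def lookup_single when_def)
  have "1 \<in> Poly_Mapping.single 0 ` A"
    using is_subring_closed(1)[OF assms] by (metis imageI single_one)
  then have "laurent A \<subseteq> laurent_extend A A"
    unfolding laurent_extend_def using mod_prod_base[of 1 _ _ "laurent A"] by auto
  moreover have "laurent_extend A A \<subseteq> laurent A"
    unfolding laurent_extend_def using s L by (intro mod_prod_least) auto
  ultimately show ?thesis by blast
qed

lemma is_submodule_laurent_extend:
  assumes "is_subring A" shows "is_submodule (laurent A) (laurent_extend A I)"
  unfolding laurent_extend_def
  using is_submodule_mod_prod[OF is_submodule_self[OF is_subring_laurent[OF assms]]]
  by (metis mod_prod_commute)

lemma mod_prod_single:
  "mod_prod (Poly_Mapping.single (0::int) ` I) (Poly_Mapping.single 0 ` J) =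
     Poly_Mapping.single 0 ` mod_prod I J"
proof
  show "mod_prod (Poly_Mapping.single (0::int) ` I) (Poly_Mapping.single 0 ` J)
          \<subseteq> Poly_Mapping.single 0 ` mod_prod I J"
  proof (rule mod_prod_least)
    show "0 \<in> Poly_Mapping.single (0::int) ` mod_prod I J"
      by (metis imageI mod_prod_zero single_zero)
  qed (auto simp: mult_single simp flip: single_add intro!: imageI mod_prod_add mod_prod_base)
  have "mod_prod I J \<subseteq> {x. Poly_Mapping.single (0::int) x \<in>
          mod_prod (Poly_Mapping.single (0::int) ` I) (Poly_Mapping.single 0 ` J)}"
  proof (rule mod_prod_least)
    fix x y assume "x \<in> I" "y \<in> J"
    then show "x * y \<in> {x. Poly_Mapping.single (0::int) x \<in>
          mod_prod (Poly_Mapping.single (0::int) ` I) (Poly_Mapping.single 0 ` J)}"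
      using mod_prod_base[of "Poly_Mapping.single (0::int) x" "Poly_Mapping.single 0 ` I"
        "Poly_Mapping.single 0 y" "Poly_Mapping.single 0 ` J"]
      by (simp add: mult_single)
  qed (auto simp: mod_prod_zero single_add intro: mod_prod_add)
  then show "Poly_Mapping.single 0 ` mod_prod I J
      \<subseteq> mod_prod (Poly_Mapping.single (0::int) ` I) (Poly_Mapping.single 0 ` J)" by blast
qed

lemma laurent_extend_mod_prod:
  assumes "is_subring A"
  shows "laurent_extend A (mod_prod I J) = mod_prod (laurent_extend A I) (laurent_extend A J)"
proof -
  let ?L = "laurent A" and ?s = "\<lambda>I. Poly_Mapping.single (0::int) ` I"
  have L: "mod_prod ?L ?L = ?L"
    using is_subring_laurent[OF assms] by (simp add: is_submodule_self mod_prod_one)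
  have "laurent_extend A (mod_prod I J) = mod_prod (mod_prod (?s I) (?s J)) (mod_prod ?L ?L)"
    by (simp add: laurent_extend_def mod_prod_single L)
  also have "\<dots> = mod_prod (?s I) (mod_prod (mod_prod (?s J) ?L) ?L)"
    by (simp add: mod_prod_assoc)
  also have "\<dots> = mod_prod (?s I) (mod_prod ?L (mod_prod (?s J) ?L))"
    by (simp add: mod_prod_commute)
  finally show ?thesis
    by (simp add: laurent_extend_def mod_prod_assoc)
qed

lemma laurent_extend_hom:
  assumes "is_subring A"
  shows "laurent_extend A \<in> hom (inv_group A) (inv_group (laurent A))"
proof (rule homI)
  fix I assume "I \<in> carrier (inv_group A)"
  then obtain J where "mod_prod I J = A"
    by (auto simp: inv_group_def invertible_submodule_def)
  then have "mod_prod (laurent_extend A I) (laurent_extend A J) = laurent A"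
    by (metis assms laurent_extend_mod_prod laurent_extend_one)
  then show "laurent_extend A I \<in> carrier (inv_group (laurent A))"
    using is_submodule_laurent_extend[OF assms]
    by (auto simp: inv_group_def invertible_submodule_def)
qed (simp add: inv_group_def laurent_extend_mod_prod[OF assms])

lemma group_MI:
  assumes "is_subring A" shows "group (MI A)"
proof -
  let ?G = "inv_group A" and ?H = "inv_group (laurent A)"
  interpret G: comm_group ?G by (rule comm_group_inv_group[OF assms])
  interpret H: comm_group ?H by (rule comm_group_inv_group[OF is_subring_laurent[OF assms]])
  interpret group_hom ?G ?H "laurent_extend A"
    by unfold_locales (rule laurent_extend_hom[OF assms])
  have "laurent_extend A ` carrier ?G \<lhd> ?H"
    by (rule H.subgroup_imp_normal[OF img_is_subgroup])
  then show ?thesis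
    unfolding MI_def by (rule normal.factorgroup_is_group)
qed

end

theory Submission
  imports Defs
begin

text \<open>
  Suppose \<open>u v = 1 + c w\<close> in \<open>B[X, X\<^sup>-\<^sup>1]\<close> with \<open>c\<close>, \<open>w\<close>, \<open>u c\<close>, \<open>v c\<close> in
  \<open>A[X, X\<^sup>-\<^sup>1]\<close>. Then \<open>(u, c)\<close> and \<open>(v, c)\<close> are mutually inverse, because
  \<open>(1 + c w) (1 - c w) + c\<^sup>2 w\<^sup>2 = 1\<close>. If \<open>MI A\<close> is trivial, both are extended from \<open>B\<close>,
  hence homogeneous, so every coefficient of \<open>u\<close> times every coefficient of \<open>v\<close> lies in
  \<open>A\<close>. Subintegral closedness follows from \<open>u = 1 + b X\<close>, \<open>v = 1 - b X\<close>, \<open>c = b\<^sup>2 X\<^sup>2\<close>, and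
  anodality from \<open>u = 1 - b + b X\<close>, \<open>v = 1 - b + b X\<^sup>-\<^sup>1\<close>, \<open>c = b\<^sup>2 - b\<close>.
\<close>

text \<open>The submodule written \<open>(u, c)\<close> in the overview; \<open>u\<close> and
  \<open>c\<close> are taken from the ambient ring, only the multipliers \<open>p\<close>,
  \<open>q\<close> from \<open>R\<close>.\<close>

definition span2 :: "'b::comm_ring_1 set \<Rightarrow> 'b \<Rightarrow> 'b \<Rightarrow> 'b set" where
  "span2 R u c = {p * u + q * c | p q. p \<in> R \<and> q \<in> R}"

lemma span2I: "p \<in> R \<Longrightarrow> q \<in> R \<Longrightarrow> p * u + q * c \<in> span2 R u c"
  unfolding span2_def by blast

lemma span2_generators:
  assumes "is_subring R" shows "u \<in> span2 R u c" "c \<in> span2 R u c"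
  using span2I[of 1 R 0 u c] span2I[of 0 R 1 u c] is_subring_closed(1,2)[OF assms] by simp_all

lemma is_submodule_span2:
  assumes "is_subring R" shows "is_submodule R (span2 R u c)"
  unfolding is_submodule_def
proof (intro conjI ballI)
  note R = is_subring_closed[OF assms]
  show "0 \<in> span2 R u c"
    using span2I[of 0 R 0 u c] R(2) by simp
  show "x + y \<in> span2 R u c" if x: "x \<in> span2 R u c" and y: "y \<in> span2 R u c" for x y
  proof -
    obtain p q where "x = p * u + q * c" "p \<in> R" "q \<in> R"
      using x unfolding span2_def by blast
    moreover obtain p' q' where "y = p' * u + q' * c" "p' \<in> R" "q' \<in> R"
      using y unfolding span2_def by blast
    ultimately show ?thesis
      using span2I[of "p + p'" R "q + q'" u c] R(4) by (simp add: algebra_simps)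
  qed
  show "a * x \<in> span2 R u c" if a: "a \<in> R" and x: "x \<in> span2 R u c" for a x
  proof -
    obtain p q where "x = p * u + q * c" "p \<in> R" "q \<in> R"
      using x unfolding span2_def by blast
    then show ?thesis
      using span2I[of "a * p" R "a * q" u c] R(5) a by (simp add: algebra_simps)
  qed
qed

text \<open>All four products of generators lie in \<open>R\<close>, which gives one inclusion.
  Conversely, \<open>u * v\<close> and \<open>c * c\<close> alone already combine to 1.\<close>

lemma mod_prod_span2:
  assumes R: "is_subring R" and uv: "u * v = 1 + c * w"
    and c: "c \<in> R" and w: "w \<in> R" and uc: "u * c \<in> R" and vc: "v * c \<in> R"
  shows "mod_prod (span2 R u c) (span2 R v c) = R"
proof
  note cl = is_subring_closed[OF R]
  have uvR: "u * v \<in> R" using uv cl c w by simp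
  show "mod_prod (span2 R u c) (span2 R v c) \<subseteq> R"
  proof (rule mod_prod_least)
    fix x y assume x: "x \<in> span2 R u c" and y: "y \<in> span2 R v c"
    obtain p q where x': "x = p * u + q * c" "p \<in> R" "q \<in> R"
      using x unfolding span2_def by blast
    obtain p' q' where y': "y = p' * v + q' * c" "p' \<in> R" "q' \<in> R"
      using y unfolding span2_def by blast
    have "x * y = p * p' * (u * v) + p * q' * (u * c) + q * p' * (v * c) + q * q' * (c * c)"
      by (simp add: x' y' algebra_simps)
    also have "\<dots> \<in> R" using x' y' cl(4,5) uvR uc vc c by simp
    finally show "x * y \<in> R" .
  qed (use cl in auto)
  let ?P = "mod_prod (span2 R u c) (span2 R v c)"
  have P: "is_submodule R ?P"
    by (rule is_submodule_mod_prod[OF is_submodule_span2[OF R]])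
  have "u * v \<in> ?P" "c * c \<in> ?P"
    by (intro mod_prod_base span2_generators[OF R])+
  moreover have "1 - c * w \<in> R" "w * w \<in> R" using cl c w by simp_all
  ultimately have "(1 - c * w) * (u * v) + w * w * (c * c) \<in> ?P"
    using P unfolding is_submodule_def by blast
  moreover have "(1 - c * w) * (u * v) + w * w * (c * c) = 1"
    by (simp add: uv algebra_simps)
  ultimately have "1 \<in> ?P" by simp
  then have "r * 1 \<in> ?P" if "r \<in> R" for r
    using P that unfolding is_submodule_def by blast
  then show "R \<subseteq> ?P" by auto
qed

text \<open>This is the homogeneity of extended modules: an element of an extended module passes
  membership on to its coefficients.\<close>

lemma lookup_laurent_extend:
  assumes "is_submodule A I" "p \<in> laurent_extend A I"
  shows "poly_mapping.lookup p i \<in> I"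
proof -
  have "laurent_extend A I \<subseteq> {p. \<forall>i. poly_mapping.lookup p i \<in> I}"
    unfolding laurent_extend_def
  proof (rule mod_prod_least)
    fix x y :: "int \<Rightarrow>\<^sub>0 'a"
    assume "x \<in> Poly_Mapping.single 0 ` I" and y: "y \<in> laurent A"
    then obtain z where z: "z \<in> I" "x = Poly_Mapping.single 0 z" by blast
    \<comment> \<open>Multiplying by the constant \<open>z\<close> scales each coefficient by
      \<open>z\<close>.\<close>
    have "poly_mapping.lookup (x * y) i = poly_mapping.lookup y i * z" for i
      unfolding z(2) mult_map_scale_conv_mult[symmetric]
      by (simp add: Poly_Mapping.map.rep_eq when_def mult.commute)
    then show "x * y \<in> {p. \<forall>i. poly_mapping.lookup p i \<in> I}"
      using y z(1) assms(1) by (simp add: laurent_def is_submodule_def)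
  qed (use assms(1) in \<open>auto simp: is_submodule_def lookup_add\<close>)
  with assms(2) show ?thesis by blast
qed

text \<open>A trivial factor group has a single coset, the subgroup of extended modules itself; the
  coset of \<open>I\<close> equals it, so \<open>I\<close> is extended.\<close>

lemma trivial_MI_extended:
  assumes A: "is_subring A" and "trivial_group (MI A)" and I: "invertible_submodule (laurent A) I"
  obtains L where "invertible_submodule A L" "I = laurent_extend A L"
proof -
  let ?G = "inv_group A" and ?H = "inv_group (laurent A)"
  let ?S = "laurent_extend A ` carrier ?G"
  interpret G: comm_group ?G by (rule comm_group_inv_group[OF A])
  interpret H: comm_group ?H by (rule comm_group_inv_group[OF is_subring_laurent[OF A]])
  interpret group_hom ?G ?H "laurent_extend A"
    by unfold_locales (rule laurent_extend_hom[OF A])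
  have S: "subgroup ?S ?H" by (rule img_is_subgroup)
  have IH: "I \<in> carrier ?H" using I by (simp add: inv_group_def)
  have "carrier (MI A) = {?S}"
    using assms(2) by (simp add: trivial_group_def MI_def FactGroup_def)
  then have "?S #>\<^bsub>?H\<^esub> I = ?S"
    using IH by (auto simp: MI_def FactGroup_def RCOSETS_def)
  then have "I \<in> ?S" using H.coset_join1[OF _ IH S] S by (simp add: subgroup.subset)
  then show thesis using that by (auto simp: inv_group_def)
qed

text \<open>The two spans are extended from some \<open>L\<close> and \<open>M\<close>, which
  contain the coefficients of \<open>u\<close> and \<open>v\<close> respectively. It remains to see
  that products from \<open>L\<close> and \<open>M\<close> fall into \<open>A\<close>.\<close>

lemma trivial_MI_coeff_mult:
  assumes A: "is_subring A" and MI: "trivial_group (MI A)"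
    and uv: "u * v = 1 + c * w"
    and mem: "c \<in> laurent A" "w \<in> laurent A" "u * c \<in> laurent A" "v * c \<in> laurent A"
  shows "poly_mapping.lookup u i * poly_mapping.lookup v j \<in> A"
proof -
  let ?R = "laurent A"
  have R: "is_subring ?R" by (rule is_subring_laurent[OF A])
  have prod: "mod_prod (span2 ?R u c) (span2 ?R v c) = ?R"
    by (rule mod_prod_span2[OF R uv mem])
  have "invertible_submodule ?R (span2 ?R u c)"
    unfolding invertible_submodule_def using prod is_submodule_span2[OF R] by blast
  then obtain L where L: "invertible_submodule A L" "span2 ?R u c = laurent_extend A L"
    by (rule trivial_MI_extended[OF A MI])
  have "invertible_submodule ?R (span2 ?R v c)"
    unfolding invertible_submodule_def
    using prod is_submodule_span2[OF R] by (metis mod_prod_commute)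
  then obtain M where M: "invertible_submodule A M" "span2 ?R v c = laurent_extend A M"
    by (rule trivial_MI_extended[OF A MI])
  let ?x = "poly_mapping.lookup u i" and ?y = "poly_mapping.lookup v j"
  have "?x \<in> L" "?y \<in> M"
    using lookup_laurent_extend L M span2_generators(1)[OF R]
    unfolding invertible_submodule_def by metis+
  then have "?x * ?y \<in> mod_prod L M" by (rule mod_prod_base)
  moreover have "laurent_extend A (mod_prod L M) = ?R"
    using laurent_extend_mod_prod[OF A, of L M] prod L(2) M(2) by simp
  \<comment> \<open>As a constant, the product lies in the extension of \<open>mod_prod L M\<close>,
    which is \<open>laurent A\<close>; its coefficient at 0 is the claim.\<close>
  ultimately have "Poly_Mapping.single 0 (?x * ?y) * 1 \<in> ?R"
    unfolding laurent_extend_def using is_subring_closed(1)[OF R] mod_prod_base by blast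
  then show ?thesis
    by (auto simp: laurent_def lookup_single dest: spec[of _ 0])
qed

lemma single_in_laurent:
  assumes "is_subring A" "a \<in> A" shows "Poly_Mapping.single i a \<in> laurent A"
  using assms is_subring_closed(2)[OF assms(1)] by (simp add: laurent_def lookup_single when_def)

theorem theorem2p17:
  fixes A :: "'b::idom set"
  assumes "is_subring A"
    and "integral_extension A"
    and "birational_extension A"
    and "trivial_group (MI A)"
  shows "subintegrally_closed A \<and> anodal A"
proof
  note A = is_subring_closed[OF assms(1)]
  note R = is_subring_closed[OF is_subring_laurent[OF assms(1)]]
  note single = single_in_laurent[OF assms(1)]
  note coeff = trivial_MI_coeff_mult[OF assms(1,4)]
  let ?s = "Poly_Mapping.single :: int \<Rightarrow> 'b \<Rightarrow> _"
  show "subintegrally_closed A"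
    unfolding subintegrally_closed_def
  proof (intro allI impI)
    fix b assume b: "b ^ 2 \<in> A \<and> b ^ 3 \<in> A"
    define u v c where "u = 1 + ?s 1 b" and "v = 1 - ?s 1 b" and "c = ?s 2 (b ^ 2)"
    have sq: "?s 1 b * ?s 1 b = c" by (simp add: c_def mult_single power2_eq_square)
    have bc: "?s 1 b * c = ?s 3 (b ^ 3)"
      by (simp add: c_def mult_single power2_eq_square power3_eq_cube mult.assoc)
    have "c \<in> laurent A" "?s 1 b * c \<in> laurent A"
      unfolding bc using b by (simp_all add: c_def single)
    moreover have "u * v = 1 + c * (- 1)"
      by (simp add: u_def v_def algebra_simps sq)
    moreover have "- 1 \<in> laurent A" using R(3)[OF R(2) R(1)] by simp
    \<comment> \<open>The two coefficients are \<open>b\<close> and 1, so their product is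
      \<open>b\<close> itself.\<close>
    ultimately have "poly_mapping.lookup u 1 * poly_mapping.lookup v 0 \<in> A"
      using R by (intro coeff[of u v c "- 1"]) (simp_all add: u_def v_def algebra_simps)
    then show "b \<in> A"
      by (simp add: u_def v_def lookup_add lookup_minus lookup_single lookup_one when_def)
  qed
  show "anodal A"
    unfolding anodal_def
  proof (intro allI impI)
    fix b assume b: "b ^ 2 - b \<in> A \<and> b ^ 3 - b ^ 2 \<in> A"
    define B X Y where "B = ?s 0 b" and "X = ?s 1 1" and "Y = ?s (- 1) 1"
    \<comment> \<open>Since \<open>X * Y = 1\<close>, expanding gives
      \<open>u * v = 1 + 2 * c - c * (X + Y)\<close>, whence this \<open>w\<close>.\<close>
    define u v c w where "u = 1 - B + B * X" and "v = 1 - B + B * Y"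
      and "c = B * B - B" and "w = 1 + 1 - X - Y"
    have XY: "X * Y = 1" by (simp add: X_def Y_def mult_single)
    have X: "X \<in> laurent A" and Y: "Y \<in> laurent A"
      unfolding X_def Y_def by (simp_all add: single A(1))
    have c: "c = ?s 0 (b ^ 2 - b)"
      by (simp add: c_def B_def mult_single single_diff power2_eq_square)
    have Bc: "B * c = ?s 0 (b ^ 3 - b ^ 2)"
      by (simp add: c B_def mult_single power2_eq_square power3_eq_cube algebra_simps)
    have cA: "c \<in> laurent A" and BcA: "B * c \<in> laurent A"
      unfolding Bc unfolding c using b by (simp_all add: single)
    have uv: "u * v = 1 + c * w"
    proof -
      have "u * v = (1 - B) * (1 - B) + (1 - B) * B * (X + Y) + B * B * (X * Y)"
        by (simp add: u_def v_def algebra_simps)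
      also have "\<dots> = 1 + c * w"
        unfolding XY by (simp add: c_def w_def algebra_simps)
      finally show ?thesis .
    qed
    have w: "w \<in> laurent A" unfolding w_def by (intro R X Y)
    \<comment> \<open>Both hypotheses on \<open>b\<close> enter here: they put \<open>c\<close> and
      \<open>B * c\<close> into \<open>laurent A\<close>.\<close>
    have "u * c = c - B * c + B * c * X" "v * c = c - B * c + B * c * Y"
      by (simp_all add: u_def v_def algebra_simps)
    then have "u * c \<in> laurent A" "v * c \<in> laurent A"
      using R cA BcA X Y by simp_all
    note in_A = coeff[OF uv cA w this]
    have BX: "B * X = ?s 1 b" and BY: "B * Y = ?s (- 1) b"
      by (simp_all add: B_def X_def Y_def mult_single)
    \<comment> \<open>The coefficient \<open>b\<close> of \<open>X\<close> in \<open>u\<close> meets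
      the coefficients \<open>1 - b\<close> and \<open>b\<close> of \<open>v\<close> at 0 and -1;
      the two products add up to \<open>b\<close>.\<close>
    have "b * (1 - b) \<in> A" "b * b \<in> A"
      using in_A[of 1 0] in_A[of 1 "- 1"] unfolding u_def v_def BX BY
      by (simp_all add: B_def lookup_add lookup_minus lookup_single lookup_one when_def)
    then have "b * (1 - b) + b * b \<in> A" by (rule A(4))
    then show "b \<in> A" by (simp add: algebra_simps)
  qed
qed

end
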